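(* Let $G=(V,E,\ell,\Phi)$ be a weak model in which every recurrent node is aperiodic. Let $(X_t)_{t\ge1}$ be a Markov chain on $V$ whose transition matrix $P$ satisfies $P_{ij}>0$ iff $(i,j)\in E$, with an initial distribution giving positive probability to every node, and let $Y_t=\ell(X_t)$. Then $$H(X|Y)=\limsup_{T\to\infty}\frac1T H(X_{[T]}\mid Y_{[T]})=0$$ if and only if every recurrent class of $G$ is trackable (as a weak model, namely the subgraph induced by the class with the restricted coloring).
   Context: A (single-colored) weak model $G=(V,E,\ell,\Phi)$ consists of a finite set of nodes $V$, directed edges $E\subseteq V\times V$, a finite color set $\Phi$ and a coloring $\ell:V\to\Phi$. For $Y_{[t]}\in\Phi^t$, $\mathcal H_G(Y_{[t]})$ is the set of walks $(x_1,\dots,x_t)$ with $(x_i,x_{i+1})\in E$ and $\ell(x_i)=Y_i$, and $n_G(t)=\max_{Y_{[t]}}|\mathcal H_G(Y_{[t]})|$; a weak model is trackable if $n_G(t)=O(t^k)$ for some $k\ge0$. Node $j$ is accessible from $i$ if there is a directed path (possibly of length zero) from $i$ to $j$; $i$ is recurrent if $i$ is accessible from every node accessible from $i$, and transient otherwise; the set of nodes accessible from a recurrent node is its recurrent class. A node is aperiodic if the greatest common divisor of the lengths of the closed walks through it is $1$. $X_{[T]}=(X_1,\dots,X_T)$, $Y_{[T]}=(Y_1,\dots,Y_T)$, and $H(X_{[T]}\mid Y_{[T]})$ is the Shannon conditional entropy (base 2). *)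

theory Defs
  imports "HOL-Analysis.Analysis" "HOL-Library.Landau_Symbols"
begin

definition weak_model :: "'v set \<Rightarrow> ('v \<times> 'v) set \<Rightarrow> ('v \<Rightarrow> 'c) \<Rightarrow> 'c set \<Rightarrow> bool" where
  "weak_model V E l Phi \<longleftrightarrow> finite V \<and> finite Phi \<and> E \<subseteq> V \<times> V \<and> l ` V \<subseteq> Phi"

definition walks :: "'v set \<Rightarrow> ('v \<times> 'v) set \<Rightarrow> ('v \<Rightarrow> 'c) \<Rightarrow> 'c list \<Rightarrow> 'v list set" where
  "walks V E l Ys = {xs. length xs = length Ys \<and> set xs \<subseteq> V
      \<and> (\<forall>i. Suc i < length xs \<longrightarrow> (xs ! i, xs ! Suc i) \<in> E)
      \<and> (\<forall>i < length xs. l (xs ! i) = Ys ! i)}"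

definition n_G :: "'v set \<Rightarrow> ('v \<times> 'v) set \<Rightarrow> ('v \<Rightarrow> 'c) \<Rightarrow> 'c set \<Rightarrow> nat \<Rightarrow> nat" where
  "n_G V E l Phi t = Max {card (walks V E l Ys) | Ys. length Ys = t \<and> set Ys \<subseteq> Phi}"

definition trackable :: "'v set \<Rightarrow> ('v \<times> 'v) set \<Rightarrow> ('v \<Rightarrow> 'c) \<Rightarrow> 'c set \<Rightarrow> bool" where
  "trackable V E l Phi \<longleftrightarrow> (\<exists>k::nat. (\<lambda>t. real (n_G V E l Phi t)) \<in> O(\<lambda>t. real t ^ k))"

definition accessible :: "('v \<times> 'v) set \<Rightarrow> 'v \<Rightarrow> 'v \<Rightarrow> bool" where
  "accessible E i j \<longleftrightarrow> (i, j) \<in> E\<^sup>*"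

definition recurrent :: "'v set \<Rightarrow> ('v \<times> 'v) set \<Rightarrow> 'v \<Rightarrow> bool" where
  "recurrent V E i \<longleftrightarrow> i \<in> V \<and> (\<forall>j. accessible E i j \<longrightarrow> accessible E j i)"

definition recurrent_class :: "('v \<times> 'v) set \<Rightarrow> 'v \<Rightarrow> 'v set" where
  "recurrent_class E i = {j. accessible E i j}"

definition aperiodic :: "('v \<times> 'v) set \<Rightarrow> 'v \<Rightarrow> bool" where
  "aperiodic E i \<longleftrightarrow> Gcd {n::nat. n > 0 \<and> (i, i) \<in> E ^^ n} = 1"

definition markov_chain :: "'v set \<Rightarrow> ('v \<times> 'v) set \<Rightarrow> ('v \<Rightarrow> 'v \<Rightarrow> real) \<Rightarrow> ('v \<Rightarrow> real) \<Rightarrow> bool" where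
  "markov_chain V E P mu \<longleftrightarrow>
     (\<forall>i\<in>V. \<forall>j\<in>V. P i j \<ge> 0 \<and> (P i j > 0 \<longleftrightarrow> (i, j) \<in> E))
   \<and> (\<forall>i\<in>V. (\<Sum>j\<in>V. P i j) = 1)
   \<and> (\<forall>i\<in>V. mu i > 0) \<and> (\<Sum>i\<in>V. mu i) = 1"

fun chain_prob :: "('v \<Rightarrow> 'v \<Rightarrow> real) \<Rightarrow> 'v \<Rightarrow> 'v list \<Rightarrow> real" where
  "chain_prob P x [] = 1"
| "chain_prob P x (y # ys) = P x y * chain_prob P y ys"

fun path_prob :: "('v \<Rightarrow> 'v \<Rightarrow> real) \<Rightarrow> ('v \<Rightarrow> real) \<Rightarrow> 'v list \<Rightarrow> real" where
  "path_prob P mu [] = 1"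
| "path_prob P mu (x # xs) = mu x * chain_prob P x xs"

definition seqs :: "'v set \<Rightarrow> nat \<Rightarrow> 'v list set" where
  "seqs V T = {xs. set xs \<subseteq> V \<and> length xs = T}"

definition obs_prob :: "'v set \<Rightarrow> ('v \<Rightarrow> 'c) \<Rightarrow> ('v \<Rightarrow> 'v \<Rightarrow> real) \<Rightarrow> ('v \<Rightarrow> real) \<Rightarrow> nat \<Rightarrow> 'c list \<Rightarrow> real" where
  "obs_prob V l P mu T ys = (\<Sum>xs\<in>{xs\<in>seqs V T. map l xs = ys}. path_prob P mu xs)"

text \<open>H(X_[T] | Y_[T]) = - sum Pr(x,y) log2 Pr(x|y); here y = map l x, and terms
  with Pr(x) = 0 contribute 0.\<close>
definition cond_entropy :: "'v set \<Rightarrow> ('v \<Rightarrow> 'c) \<Rightarrow> ('v \<Rightarrow> 'v \<Rightarrow> real) \<Rightarrow> ('v \<Rightarrow> real) \<Rightarrow> nat \<Rightarrow> real" where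
  "cond_entropy V l P mu T =
     - (\<Sum>xs\<in>seqs V T. path_prob P mu xs *
          log 2 (path_prob P mu xs / obs_prob V l P mu T (map l xs)))"

definition cond_entropy_rate :: "'v set \<Rightarrow> ('v \<Rightarrow> 'c) \<Rightarrow> ('v \<Rightarrow> 'v \<Rightarrow> real) \<Rightarrow> ('v \<Rightarrow> real) \<Rightarrow> ereal" where
  "cond_entropy_rate V l P mu =
     limsup (\<lambda>T. ereal (cond_entropy V l P mu T / real T))"

end

theory Submission
  imports Defs "HOL-Real_Asymp.Real_Asymp"
begin

text \<open>
  Suppose all recurrent classes are trackable. By Gibbs' inequality it suffices to find, for every
  observation, a subprobability on the hidden sequences whose expected code length is $o(T)$. Take
  $q(x) = 1 / ((T+1)\, |V|^{\tau(x)}\, D (T+1)^k)$, where $\tau(x)$ is the time spent in transient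
  states, whose expectation is bounded by a Foster drift argument.

  Conversely, if each loop of a class is determined by its base point and colors, then a walk is
  determined by its observation and the first and last visits to each node, so the class is
  trackable. In an untrackable class there are hence two distinct loops of equal length and equal
  colors through some node $v$. Whenever the chain is at $v$, it runs through the one or the other
  with positive probability without the observer being able to tell which, and by the drift
  argument this happens with positive frequency.
\<close>

section \<open>Counting walks\<close>

lemma finite_walks: "finite V \<Longrightarrow> finite (walks V E l ys)"
  by (rule finite_subset[OF _ finite_lists_length_eq[of V "length ys"]]) (auto simp: walks_def)

lemma card_walks_le_n_G:
  assumes "finite Phi" "set ys \<subseteq> Phi"
  shows "card (walks V E l ys) \<le> n_G V E l Phi (length ys)"
proof -
  have "{card (walks V E l zs) |zs. length zs = length ys \<and> set zs \<subseteq> Phi}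
      = (\<lambda>zs. card (walks V E l zs)) ` {zs. set zs \<subseteq> Phi \<and> length zs = length ys}"
    by auto
  then show ?thesis
    unfolding n_G_def using assms by (auto intro!: Max_ge simp: finite_lists_length_eq)
qed

lemma n_G_le:
  assumes "finite Phi" "Phi \<noteq> {}"
    and "\<And>ys. length ys = t \<Longrightarrow> card (walks V E l ys) \<le> B"
  shows "n_G V E l Phi t \<le> B"
proof -
  have eq: "{card (walks V E l zs) |zs. length zs = t \<and> set zs \<subseteq> Phi}
      = (\<lambda>zs. card (walks V E l zs)) ` {zs. set zs \<subseteq> Phi \<and> length zs = t}"
    by auto
  obtain c where "c \<in> Phi" using assms(2) by blast
  then have "replicate t c \<in> {zs. set zs \<subseteq> Phi \<and> length zs = t}" by auto
  then have ne: "{zs. set zs \<subseteq> Phi \<and> length zs = t} \<noteq> {}" by blast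
  show ?thesis
    unfolding n_G_def eq using assms ne by (subst Max_le_iff) (auto simp: finite_lists_length_eq)
qed

lemma walks_segment:
  assumes "xs \<in> walks V E l ys" "a \<le> b" "b < length xs"
  shows "take (Suc b - a) (drop a xs) \<in> walks V E l (take (Suc b - a) (drop a ys))"
proof -
  have "set (take (Suc b - a) (drop a xs)) \<subseteq> set xs"
    by (meson set_drop_subset set_take_subset subset_trans)
  then show ?thesis using assms by (auto simp: walks_def)
qed

text \<open>A loop of length n is a list of n + 1 entries whose first and last entry are the base
  point; a singleton is the trivial loop. A violation of this property supplies the two confusable
  loops of the lower bound.\<close>

definition loops_unique :: "'v set \<Rightarrow> ('v \<times> 'v) set \<Rightarrow> ('v \<Rightarrow> 'c) \<Rightarrow> bool" where
  "loops_unique V E l \<longleftrightarrow> (\<forall>ys. \<forall>xs\<in>walks V E l ys. \<forall>xs'\<in>walks V E l ys.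
     xs \<noteq> [] \<longrightarrow> hd xs = last xs \<longrightarrow> hd xs' = hd xs \<longrightarrow> last xs' = last xs \<longrightarrow> xs = xs')"

text \<open>Recording the first and last visit to each node is injective: a position t with node v
  lies between the first and last visit to v, and that segment is a loop at v with known colors,
  hence the same in both walks.\<close>

lemma card_walks_loops_unique:
  assumes "finite V" "loops_unique V E l"
  shows "card (walks V E l ys) \<le> (Suc (length ys) * Suc (length ys)) ^ card V"
proof -
  define T where "T = length ys"
  define A where "A = (\<lambda>(xs::'a list) v. {i. i < T \<and> xs ! i = v})"
  \<comment> \<open>The defaults T and 0 keep \<open>Min\<close> and \<open>Max\<close> defined for
    unvisited nodes. T is never a position, so this default differs from every real first
    visit.\<close>
  define F where "F = (\<lambda>xs. restrict (\<lambda>v. (Min (insert T (A xs v)), Max (insert 0 (A xs v)))) V)"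
  have finA: "finite (A xs v)" for xs v by (auto simp: A_def)
  have bound: "Min (insert T (A xs v)) \<le> T" "Max (insert 0 (A xs v)) \<le> T" for xs v
    using finA[of xs v] by (auto simp: A_def)
  have "inj_on F (walks V E l ys)"
  proof (rule inj_onI)
    fix xs xs' assume w: "xs \<in> walks V E l ys" "xs' \<in> walks V E l ys" and F: "F xs = F xs'"
    have len: "length xs = T" "length xs' = T" using w by (auto simp: walks_def T_def)
    show "xs = xs'"
    proof (rule nth_equalityI)
      show "length xs = length xs'" using len by simp
      fix t assume "t < length xs"
      then have t: "t < T" using len by simp
      define v where "v = xs ! t"
      have v: "v \<in> V" using w t len by (auto simp: walks_def v_def)
      have tA: "t \<in> A xs v" using t by (simp add: A_def v_def)
      define a where "a = Min (insert T (A xs v))"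
      define b where "b = Max (insert 0 (A xs v))"
      have "F xs v = (a, b)" using v by (simp add: F_def a_def b_def)
      then have a': "a = Min (insert T (A xs' v))" and b': "b = Max (insert 0 (A xs' v))"
        using v fun_cong[OF F, of v] by (auto simp: F_def)
      have at: "a \<le> t" using tA finA unfolding a_def by (intro Min_le) auto
      have bt: "t \<le> b" using tA finA unfolding b_def by (intro Max_ge) auto
      have "a \<in> insert T (A xs v)" unfolding a_def by (rule Min_in) (use finA in auto)
      then have aA: "a \<in> A xs v" using at t by auto
      have "a \<in> insert T (A xs' v)" unfolding a' by (rule Min_in) (use finA in auto)
      then have aA': "a \<in> A xs' v" using at t by auto
      have "b \<in> insert 0 (A xs v)" unfolding b_def by (rule Max_in) (use finA in auto)
      \<comment> \<open>0 may be the default as well as a position; but if b = 0, then a \<le> t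
        \<le> b forces a = 0, and a is a visit.\<close>
      then have bA: "b \<in> A xs v" using at bt aA by (cases "b = 0") auto
      have "b \<in> insert 0 (A xs' v)" unfolding b' by (rule Max_in) (use finA in auto)
      then have bA': "b \<in> A xs' v" using at bt aA' by (cases "b = 0") auto
      have bT: "b < T" using bA by (simp add: A_def)
      define S where "S = (\<lambda>zs::'a list. take (Suc b - a) (drop a zs))"
      have ends: "S zs \<noteq> []" "hd (S zs) = v" "last (S zs) = v"
        if "length zs = T" "a \<in> A zs v" "b \<in> A zs v" for zs
      proof -
        have l: "length (S zs) = Suc b - a" using that bT by (simp add: S_def)
        then show ne: "S zs \<noteq> []" using at bt by auto
        show "hd (S zs) = v" using that ne l at bt bT
          by (simp add: hd_conv_nth) (simp add: S_def A_def)
        show "last (S zs) = v" using that ne l at bt bT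
          by (simp add: last_conv_nth) (simp add: S_def A_def)
      qed
      have "S xs = S xs'"
      proof -
        have "take (Suc b - a) (drop a xs) \<in> walks V E l (take (Suc b - a) (drop a ys))"
          "take (Suc b - a) (drop a xs') \<in> walks V E l (take (Suc b - a) (drop a ys))"
          using walks_segment[of _ V E l ys a b] w at bt bT len by auto
        then show ?thesis
          using assms(2) ends[OF len(1) aA bA] ends[OF len(2) aA' bA']
          unfolding loops_unique_def S_def by metis
      qed
      then have "S xs ! (t - a) = S xs' ! (t - a)" by simp
      then show "xs ! t = xs' ! t" using at bt bT len by (simp add: S_def)
    qed
  qed
  moreover have "F ` walks V E l ys \<subseteq> (\<Pi>\<^sub>E v\<in>V. {..T} \<times> {..T})"
    using bound by (auto simp: F_def)
  moreover have "finite (\<Pi>\<^sub>E v\<in>V. {..T} \<times> {..T})" using assms by (intro finite_PiE) auto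
  ultimately have "card (walks V E l ys) \<le> card (\<Pi>\<^sub>E v\<in>V. {..T} \<times> {..T})"
    by (rule card_inj_on_le)
  then show ?thesis using assms(1) by (simp add: card_PiE T_def)
qed

lemma loops_unique_imp_trackable:
  assumes "finite V" "finite Phi" "Phi \<noteq> {}" "loops_unique V E l"
  shows "trackable V E l Phi"
proof -
  define k where "k = 2 * card V"
  have "n_G V E l Phi t \<le> (Suc t * Suc t) ^ card V" for t
    using card_walks_loops_unique[OF assms(1,4)] by (intro n_G_le assms) metis
  then have le: "n_G V E l Phi t \<le> (Suc t) ^ k" for t
    by (simp add: k_def power_mult power2_eq_square)
  have "(\<lambda>t. real (n_G V E l Phi t)) \<in> O(\<lambda>t. real t ^ k)"
  \<comment> \<open>The constant comes from \<open>Suc t \<le> 2 * t\<close> for t \<ge> 1.\<close>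
  proof (rule bigoI[where c = "2 ^ k"])
    show "\<forall>\<^sub>F t in at_top. norm (real (n_G V E l Phi t)) \<le> 2 ^ k * norm (real t ^ k)"
      using eventually_ge_at_top[of 1]
    proof eventually_elim
      case (elim t)
      have "real (n_G V E l Phi t) \<le> real ((Suc t) ^ k)" using le by (simp only: of_nat_le_iff)
      also have "\<dots> \<le> (2 * real t) ^ k" unfolding of_nat_power using elim by (intro power_mono) auto
      finally show ?case by (simp add: power_mult_distrib)
    qed
  qed
  then show ?thesis by (auto simp: trackable_def)
qed

text \<open>The finitely many times below the threshold are absorbed into the constant.
  \<open>Suc t\<close> replaces t because t ^ k vanishes at t = 0 for k > 0, while the empty walk is
  always counted.\<close>

lemma trackable_bound:
  assumes "trackable V E l Phi"
  obtains c k where "c \<ge> 0" "\<And>t. real (n_G V E l Phi t) \<le> c * real (Suc t) ^ k"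
proof -
  obtain k where k: "(\<lambda>t. real (n_G V E l Phi t)) \<in> O(\<lambda>t. real t ^ k)"
    using assms by (auto simp: trackable_def)
  then obtain c where c: "c > 0" and
    "\<forall>\<^sub>F t in at_top. norm (real (n_G V E l Phi t)) \<le> c * norm (real t ^ k)"
    by (elim landau_o.bigE)
  then obtain t0 where t0: "\<And>t. t \<ge> t0 \<Longrightarrow> real (n_G V E l Phi t) \<le> c * real t ^ k"
    by (auto simp: eventually_at_top_linorder)
  define d where "d = c + (\<Sum>t<t0. real (n_G V E l Phi t))"
  have dc: "d \<ge> c" by (auto simp: d_def sum_nonneg)
  have "real (n_G V E l Phi t) \<le> d * real (Suc t) ^ k" for t
  proof (cases "t \<ge> t0")
    case True
    have "real (n_G V E l Phi t) \<le> c * real t ^ k" by (rule t0[OF True])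
    also have "\<dots> \<le> d * real (Suc t) ^ k"
      using c dc by (intro mult_mono power_mono) auto
    finally show ?thesis .
  next
    case False
    then have "real (n_G V E l Phi t) \<le> (\<Sum>t<t0. real (n_G V E l Phi t))"
      by (intro member_le_sum) auto
    then have "real (n_G V E l Phi t) \<le> d * 1" using c by (simp add: d_def)
    also have "\<dots> \<le> d * real (Suc t) ^ k"
      using c dc by (intro mult_left_mono one_le_power) auto
    finally show ?thesis .
  qed
  moreover have "d \<ge> 0" using c dc by linarith
  ultimately show thesis by (rule that[rotated])
qed

section \<open>Sums over sequences\<close>

lemma finite_seqs [simp]: "finite V \<Longrightarrow> finite (seqs V T)"
  unfolding seqs_def by (rule finite_lists_length_eq)

lemma card_seqs: "finite V \<Longrightarrow> card (seqs V T) = card V ^ T"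
  unfolding seqs_def by (rule card_lists_length_eq)

lemma seqs_0 [simp]: "seqs V 0 = {[]}"
  by (auto simp: seqs_def)

lemma sum_seqs_append:
  "(\<Sum>xs\<in>seqs V (L + T). g xs) = (\<Sum>ws\<in>seqs V L. \<Sum>zs\<in>seqs V T. g (ws @ zs))"
proof -
  have "(\<Sum>ws\<in>seqs V L. \<Sum>zs\<in>seqs V T. g (ws @ zs)) =
      (\<Sum>(ws, zs)\<in>seqs V L \<times> seqs V T. g (ws @ zs))"
    by (rule sum.cartesian_product)
  also have "\<dots> = (\<Sum>xs\<in>seqs V (L + T). g xs)"
  proof (rule sum.reindex_bij_witness[where i = "\<lambda>xs. (take L xs, drop L xs)"
        and j = "\<lambda>(ws, zs). ws @ zs"])
    show "(take L xs, drop L xs) \<in> seqs V L \<times> seqs V T" if "xs \<in> seqs V (L + T)" for xs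
      using that set_take_subset[of L xs] set_drop_subset[of L xs] by (auto simp: seqs_def)
  qed (auto simp: seqs_def)
  finally show ?thesis by simp
qed

lemma sum_seqs_1: "(\<Sum>xs\<in>seqs V 1. g xs) = (\<Sum>x\<in>V. g [x])"
proof -
  have "seqs V 1 = (\<lambda>x. [x]) ` V" by (auto simp: seqs_def length_Suc_conv)
  then show ?thesis by (simp add: sum.reindex inj_on_def)
qed

lemma sum_seqs_Suc: "(\<Sum>xs\<in>seqs V (Suc T). g xs) = (\<Sum>x\<in>V. \<Sum>zs\<in>seqs V T. g (x # zs))"
  using sum_seqs_append[of g V 1 T] sum_seqs_1[of "\<lambda>ws. \<Sum>zs\<in>seqs V T. g (ws @ zs)" V] by simp

lemma chain_prob_append:
  "chain_prob P i (ws @ zs) = chain_prob P i ws * chain_prob P (last (i # ws)) zs"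
  by (induction ws arbitrary: i) auto


section \<open>Partially observed Markov chains\<close>

locale observed_chain =
  fixes V :: "'v set" and E :: "('v \<times> 'v) set" and l :: "'v \<Rightarrow> 'c" and Phi :: "'c set"
    and P :: "'v \<Rightarrow> 'v \<Rightarrow> real" and mu :: "'v \<Rightarrow> real"
  assumes model: "weak_model V E l Phi" and chain: "markov_chain V E P mu"
begin

lemma finV [simp]: "finite V" and finPhi: "finite Phi" and EV: "E \<subseteq> V \<times> V" and lV: "l ` V \<subseteq> Phi"
  using model by (auto simp: weak_model_def)

lemma P_nonneg: "i \<in> V \<Longrightarrow> j \<in> V \<Longrightarrow> 0 \<le> P i j"
  and P_pos_iff: "i \<in> V \<Longrightarrow> j \<in> V \<Longrightarrow> 0 < P i j \<longleftrightarrow> (i, j) \<in> E"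
  and P_sum: "i \<in> V \<Longrightarrow> (\<Sum>j\<in>V. P i j) = 1"
  and mu_pos: "i \<in> V \<Longrightarrow> 0 < mu i" and mu_sum: "(\<Sum>i\<in>V. mu i) = 1"
  using chain by (auto simp: markov_chain_def)

lemma V_nonempty: "V \<noteq> {}"
  using mu_sum by auto

lemma chain_prob_nonneg: "i \<in> V \<Longrightarrow> set xs \<subseteq> V \<Longrightarrow> 0 \<le> chain_prob P i xs"
  by (induction xs arbitrary: i) (auto simp: P_nonneg)

lemma chain_prob_sum: "i \<in> V \<Longrightarrow> (\<Sum>xs\<in>seqs V T. chain_prob P i xs) = 1"
proof (induction T arbitrary: i)
  case (Suc T)
  then show ?case by (simp add: sum_seqs_Suc sum_distrib_left[symmetric] P_sum)
qed simp

lemma path_prob_nonneg: "set xs \<subseteq> V \<Longrightarrow> 0 \<le> path_prob P mu xs"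
  by (cases xs) (auto intro!: mult_nonneg_nonneg chain_prob_nonneg less_imp_le[OF mu_pos])

lemma path_prob_sum: "(\<Sum>xs\<in>seqs V T. path_prob P mu xs) = 1"
proof (cases T)
  case (Suc T')
  then show ?thesis by (simp add: sum_seqs_Suc sum_distrib_left[symmetric] chain_prob_sum mu_sum)
qed simp

lemma chain_prob_pos_iff:
  assumes "i \<in> V" "set xs \<subseteq> V"
  shows "0 < chain_prob P i xs \<longleftrightarrow>
    (\<forall>n. Suc n < length (i # xs) \<longrightarrow> ((i # xs) ! n, (i # xs) ! Suc n) \<in> E)"
  using assms
proof (induction xs arbitrary: i)
  case (Cons x xs)
  have "0 < chain_prob P i (x # xs) \<longleftrightarrow> 0 < P i x \<and> 0 < chain_prob P x xs"
    using Cons.prems P_nonneg[of i x] chain_prob_nonneg[of x xs]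
    by (auto simp: zero_less_mult_iff)
  also have "\<dots> \<longleftrightarrow> (i, x) \<in> E \<and>
      (\<forall>n. Suc n < length (x # xs) \<longrightarrow> ((x # xs) ! n, (x # xs) ! Suc n) \<in> E)"
    using Cons P_pos_iff by auto
  also have "\<dots> \<longleftrightarrow> (\<forall>n. Suc n < length (i # x # xs) \<longrightarrow>
      ((i # x # xs) ! n, (i # x # xs) ! Suc n) \<in> E)"
    by (auto simp: nth_Cons split: nat.splits)
  finally show ?case .
qed simp

lemma chain_prob_pos_last:
  assumes "i \<in> V" "set xs \<subseteq> V" "0 < chain_prob P i xs"
  shows "(i, last (i # xs)) \<in> E\<^sup>*"
  using assms
proof (induction xs arbitrary: i)
  case (Cons x xs)
  have "0 < P i x" "0 < chain_prob P x xs"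
    using Cons.prems P_nonneg[of i x] chain_prob_nonneg[of x xs]
    by (auto simp: zero_less_mult_iff)
  then show ?case
    using Cons.IH[of x] Cons.prems P_pos_iff[of i x] by (auto intro: converse_rtrancl_into_rtrancl)
qed simp

section \<open>Accessibility of recurrent nodes and drift towards a target set\<close>

lemma accessible_in_V:
  assumes "i \<in> V" "accessible E i j"
  shows "j \<in> V"
  using assms(2,1) unfolding accessible_def by (induction rule: rtrancl_induct) (use EV in auto)

text \<open>A node that is not recurrent leads to some j without return, and the set of nodes
  accessible from j is strictly smaller; hence an induction on the size of the accessible
  set.\<close>

lemma reaches_recurrent:
  assumes "i \<in> V"
  obtains r where "recurrent V E r" "(i, r) \<in> E\<^sup>*"
proof -
  have "\<exists>r. recurrent V E r \<and> (i, r) \<in> E\<^sup>*"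
    using assms
  proof (induction "card (recurrent_class E i)" arbitrary: i rule: less_induct)
    case less
    show ?case
    proof (cases "recurrent V E i")
      case False
      then obtain j where j: "accessible E i j" "\<not> accessible E j i"
        using less.prems by (auto simp: recurrent_def)
      have "recurrent_class E i \<subseteq> V"
        using accessible_in_V less.prems by (auto simp: recurrent_class_def)
      then have "finite (recurrent_class E i)" using finV by (rule finite_subset)
      moreover have "recurrent_class E j \<subset> recurrent_class E i"
        using j unfolding recurrent_class_def accessible_def by (auto intro: rtrancl_trans)
      ultimately have "card (recurrent_class E j) < card (recurrent_class E i)"
        by (rule psubset_card_mono)
      then obtain r where "recurrent V E r" "(j, r) \<in> E\<^sup>*"
        using less.hyps accessible_in_V less.prems j(1) by blast
      then show ?thesis using j(1) by (auto simp: accessible_def intro: rtrancl_trans)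
    qed auto
  qed
  then show thesis using that by blast
qed

text \<open>Foster's drift condition. The Lyapunov function is $1 - (p/2)^{d(i)}$, where $d$ is the
  distance to the target and $p$ a lower bound for the positive transition probabilities.\<close>

lemma drift_function:
  assumes "S \<subseteq> V" and "\<And>i. i \<in> S \<Longrightarrow> \<exists>a\<in>A. (i, a) \<in> E\<^sup>*"
  obtains f :: "'v \<Rightarrow> real" and \<delta> where "\<delta> > 0" "\<And>i. 0 \<le> f i" "\<And>i. f i \<le> 1" "\<And>i. i \<in> A \<Longrightarrow> f i = 0"
    "\<And>i. i \<in> S \<Longrightarrow> i \<notin> A \<Longrightarrow> (\<Sum>j\<in>V. P i j * f j) \<le> f i - \<delta>"
proof -
  define p where "p = Min (insert 1 ((\<lambda>(i, j). P i j) ` E))"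
  have finE: "finite E" using EV finV by (meson finite_SigmaI finite_subset)
  have p_le: "p \<le> P i j" if "(i, j) \<in> E" for i j
    unfolding p_def using that finE by (intro Min_le) auto
  have p1: "p \<le> 1" unfolding p_def using finE by (intro Min_le) auto
  have p0: "p > 0"
    unfolding p_def using finE EV P_pos_iff by (subst Min_gr_iff) auto
  \<comment> \<open>Where A is out of reach, \<open>LEAST\<close> is unspecified, which is harmless:
    the powers of p / 2 lie in [0, 1] for every exponent.\<close>
  define d where "d = (\<lambda>i. LEAST n. \<exists>a\<in>A. (i, a) \<in> E ^^ n)"
  define f where "f = (\<lambda>i. 1 - (p / 2) ^ d i)"
  \<comment> \<open>A crude common bound on the distances from S, so that the drift (p / 2) ^ n is
    uniform.\<close>
  define n where "n = (\<Sum>i\<in>S. d i)"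
  have dn: "d i \<le> n" if "i \<in> S" for i
    unfolding n_def using that finite_subset[OF assms(1) finV] by (intro member_le_sum) auto
  have pow: "0 \<le> (p / 2) ^ m" "(p / 2) ^ m \<le> 1" for m
    using p0 p1 by (auto intro!: power_le_one)
  show thesis
  proof (rule that)
    show "0 < (p / 2) ^ n" using p0 by simp
    show "0 \<le> f i" "f i \<le> 1" for i using pow by (auto simp: f_def)
    show "f i = 0" if "i \<in> A" for i
    proof -
      have "d i = 0" unfolding d_def using that by (intro Least_eq_0) auto
      then show ?thesis by (simp add: f_def)
    qed
    show "(\<Sum>j\<in>V. P i j * f j) \<le> f i - (p / 2) ^ n" if i: "i \<in> S" "i \<notin> A" for i
    proof -
      have iV: "i \<in> V" using i assms(1) by auto
      obtain a where "a \<in> A" "(i, a) \<in> E\<^sup>*" using assms(2)[OF i(1)] by blast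
      then obtain n' where "(i, a) \<in> E ^^ n'" using rtrancl_imp_relpow by blast
      then have "\<exists>n. \<exists>a\<in>A. (i, a) \<in> E ^^ n" using \<open>a \<in> A\<close> by blast
      then have "\<exists>a\<in>A. (i, a) \<in> E ^^ d i" unfolding d_def by (rule LeastI_ex)
      then obtain b where b: "b \<in> A" "(i, b) \<in> E ^^ d i" by blast
      \<comment> \<open>Outside A the distance is positive, so a first edge leads to some j that is
        closer to A.\<close>
      with i(2) obtain m where m: "d i = Suc m" by (cases "d i") auto
      then obtain j where j: "(i, j) \<in> E" "(j, b) \<in> E ^^ m"
        using b relpow_Suc_D2[of i b m E] by auto
      have "d j \<le> m" unfolding d_def by (rule Least_le) (use b j in blast)
      then have "(p / 2) ^ m \<le> (p / 2) ^ d j" using p0 p1 by (intro power_decreasing) auto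
      then have "p * (p / 2) ^ m \<le> P i j * (p / 2) ^ d j"
        using p_le[OF j(1)] p0 by (intro mult_mono) auto
      also have "\<dots> \<le> (\<Sum>j\<in>V. P i j * (p / 2) ^ d j)"
        using j EV iV p0 by (intro member_le_sum) (auto intro!: mult_nonneg_nonneg P_nonneg)
      \<comment> \<open>Since p * (p / 2) ^ m = 2 * (p / 2) ^ Suc m, the base p / 2 instead of p
        makes the mean of the power at least double in one step; the surplus is the drift.\<close>
      finally have "2 * (p / 2) ^ d i \<le> (\<Sum>j\<in>V. P i j * (p / 2) ^ d j)" by (simp add: m)
      moreover have "(p / 2) ^ n \<le> (p / 2) ^ d i"
        using p0 p1 dn[OF i(1)] by (intro power_decreasing) auto
      moreover have "(\<Sum>j\<in>V. P i j * f j) = 1 - (\<Sum>j\<in>V. P i j * (p / 2) ^ d j)"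
        by (simp add: f_def right_diff_distrib sum_subtractf P_sum[OF iV])
      ultimately show ?thesis by (simp add: f_def)
    qed
  qed
qed


section \<open>Trackable recurrent classes: upper bound\<close>

lemma path_prob_le_obs_prob:
  assumes "xs \<in> seqs V T"
  shows "path_prob P mu xs \<le> obs_prob V l P mu T (map l xs)"
  unfolding obs_prob_def
proof (rule member_le_sum)
  show "finite {xs' \<in> seqs V T. map l xs' = map l xs}" by simp
qed (use assms path_prob_nonneg in \<open>auto simp: seqs_def\<close>)

text \<open>This is Gibbs' inequality on each fibre of \<open>map l\<close>, from ln x \<le> x - 1:
  code lengths given by a subprobability on the fibre cannot beat the conditional law.\<close>

lemma cond_entropy_le:
  assumes q_pos: "\<And>xs. xs \<in> seqs V T \<Longrightarrow> path_prob P mu xs > 0 \<Longrightarrow> q xs > 0"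
    and q_sum: "\<And>xs. xs \<in> seqs V T \<Longrightarrow>
      (\<Sum>xs' | xs' \<in> seqs V T \<and> map l xs' = map l xs \<and> path_prob P mu xs' > 0. q xs') \<le> 1"
  shows "cond_entropy V l P mu T \<le> (\<Sum>xs\<in>seqs V T. path_prob P mu xs * - log 2 (q xs))"
proof -
  define p where "p = path_prob P mu"
  define Ob where "Ob = (\<lambda>xs. obs_prob V l P mu T (map l xs))"
  \<comment> \<open>\<open>q\<close> is constrained only where the path probability is positive, so
    it is cut off elsewhere.\<close>
  define q' where "q' = (\<lambda>xs. if p xs > 0 then q xs else 0)"
  have p0: "p xs \<ge> 0" if "xs \<in> seqs V T" for xs
    using that path_prob_nonneg by (auto simp: p_def seqs_def)
  \<comment> \<open>The tangent bound at each sequence; the error terms sum to at most 0 because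
    \<open>q'\<close> has mass at most 1 on each fibre.\<close>
  have "- (p xs * log 2 (p xs / Ob xs)) \<le> p xs * - log 2 (q xs) + (q' xs * Ob xs - p xs) / ln 2"
    if xs: "xs \<in> seqs V T" for xs
  proof (cases "p xs > 0")
    case True
    have Ob: "Ob xs > 0"
      using path_prob_le_obs_prob[OF xs] True by (simp add: Ob_def p_def)
    have q: "q xs > 0" using q_pos[OF xs] True by (simp add: p_def)
    have "ln (q xs * Ob xs / p xs) \<le> q xs * Ob xs / p xs - 1"
      using True Ob q by (intro ln_le_minus_one) auto
    then have "log 2 (q xs * Ob xs / p xs) \<le> (q xs * Ob xs / p xs - 1) / ln 2"
      by (simp add: log_def divide_right_mono)
    moreover have "log 2 (q xs * Ob xs / p xs) = log 2 (q xs) - log 2 (p xs / Ob xs)"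
      using True Ob q by (simp add: log_mult log_divide)
    ultimately have "- log 2 (p xs / Ob xs) \<le> - log 2 (q xs) + (q xs * Ob xs / p xs - 1) / ln 2"
      by simp
    then have "p xs * - log 2 (p xs / Ob xs)
        \<le> p xs * (- log 2 (q xs) + (q xs * Ob xs / p xs - 1) / ln 2)"
      using True by (intro mult_left_mono) auto
    also have "\<dots> = p xs * - log 2 (q xs) + (q' xs * Ob xs - p xs) / ln 2"
      using True by (simp add: q'_def field_simps)
    finally show ?thesis by simp
  next
    case False
    then have "p xs = 0" using p0[OF xs] by simp
    then show ?thesis by (simp add: q'_def)
  qed
  then have "(\<Sum>xs\<in>seqs V T. - (p xs * log 2 (p xs / Ob xs)))
      \<le> (\<Sum>xs\<in>seqs V T. p xs * - log 2 (q xs) + (q' xs * Ob xs - p xs) / ln 2)"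
    by (rule sum_mono)
  also have "\<dots> = (\<Sum>xs\<in>seqs V T. p xs * - log 2 (q xs))
      + ((\<Sum>xs\<in>seqs V T. q' xs * Ob xs) - 1) / ln 2"
    using path_prob_sum[of T]
    by (simp only: sum.distrib sum_divide_distrib[symmetric] sum_subtractf p_def)
  also have "(\<Sum>xs\<in>seqs V T. q' xs * Ob xs) \<le> 1"
  proof -
    have "(\<Sum>xs\<in>seqs V T. q' xs * Ob xs)
        = (\<Sum>xs\<in>seqs V T. \<Sum>xs' | xs' \<in> seqs V T \<and> map l xs' = map l xs. q' xs * p xs')"
      by (simp add: Ob_def obs_prob_def p_def sum_distrib_left)
    \<comment> \<open>Both sums run over pairs with the same observation. Once swapped, the inner
      sum is the mass of \<open>q'\<close> on one fibre times a path probability.\<close>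
    also have "\<dots> = (\<Sum>xs'\<in>seqs V T. \<Sum>xs | xs \<in> seqs V T \<and> map l xs' = map l xs. q' xs * p xs')"
      by (rule sum.swap_restrict) auto
    also have "\<dots> \<le> (\<Sum>xs'\<in>seqs V T. p xs')"
    proof (rule sum_mono)
      fix xs' assume xs': "xs' \<in> seqs V T"
      have "(\<Sum>xs | xs \<in> seqs V T \<and> map l xs' = map l xs. q' xs)
          = (\<Sum>xs | xs \<in> seqs V T \<and> map l xs = map l xs' \<and> path_prob P mu xs > 0. q xs)"
        by (rule sum.mono_neutral_cong_right) (auto simp: q'_def p_def)
      also have "\<dots> \<le> 1" by (rule q_sum[OF xs'])
      finally have "(\<Sum>xs | xs \<in> seqs V T \<and> map l xs' = map l xs. q' xs) * p xs' \<le> 1 * p xs'"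
        using p0[OF xs'] by (rule mult_right_mono)
      then show "(\<Sum>xs | xs \<in> seqs V T \<and> map l xs' = map l xs. q' xs * p xs') \<le> p xs'"
        by (simp add: sum_distrib_right)
    qed
    also have "\<dots> = 1" by (simp add: p_def path_prob_sum)
    finally show ?thesis .
  qed
  finally show ?thesis
    by (simp add: cond_entropy_def p_def Ob_def sum_negf divide_right_mono)
qed

lemma cond_entropy_nonneg: "0 \<le> cond_entropy V l P mu T"
proof -
  have "path_prob P mu xs * log 2 (path_prob P mu xs / obs_prob V l P mu T (map l xs)) \<le> 0"
    if xs: "xs \<in> seqs V T" for xs
  proof (cases "path_prob P mu xs = 0")
    case False
    then have "path_prob P mu xs > 0"
      using path_prob_nonneg[of xs] xs by (simp add: seqs_def)
    with path_prob_le_obs_prob[OF xs] show ?thesis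
      by (intro mult_nonneg_nonpos) auto
  qed simp
  then show ?thesis unfolding cond_entropy_def by (simp add: sum_nonpos)
qed

section \<open>The time before a recurrent class is entered\<close>

text \<open>A recurrent class is never left, so along a sequence of positive probability the prefix
  before the first recurrent node is all the time spent in transient states.\<close>

definition transient_time :: "'v list \<Rightarrow> nat" where
  "transient_time xs = length (takeWhile (\<lambda>i. \<not> recurrent V E i) xs)"

lemma transient_time_le: "transient_time xs \<le> length xs"
  by (simp add: transient_time_def length_takeWhile_le)

text \<open>With the recurrent nodes as target of the drift, f / \<delta> falls on average by at
  least 1 per transient step; so f i / \<delta> dominates the expected transient time from i,
  uniformly in T.\<close>

lemma expected_transient_time:
  obtains B where "\<And>T. (\<Sum>xs\<in>seqs V T. path_prob P mu xs * real (transient_time xs)) \<le> B"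
proof -
  have reach: "\<exists>r\<in>{i. recurrent V E i}. (i, r) \<in> E\<^sup>*" if "i \<in> V" for i
    using reaches_recurrent[OF that] by blast
  obtain f \<delta> where \<delta>: "\<delta> > 0" and f: "\<And>i. 0 \<le> f i" "\<And>i. f i \<le> 1"
    and "\<And>i. i \<in> {i. recurrent V E i} \<Longrightarrow> f i = 0"
    and drift: "\<And>i. i \<in> V \<Longrightarrow> i \<notin> {i. recurrent V E i} \<Longrightarrow> (\<Sum>j\<in>V. P i j * f j) \<le> f i - \<delta>"
    by (rule drift_function[OF subset_refl reach], assumption) (rule that)
  have 1: "(\<Sum>xs\<in>seqs V T. chain_prob P i xs * real (transient_time (i # xs))) \<le> f i / \<delta>"
    if "i \<in> V" for i T
    using that
  proof (induction T arbitrary: i)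
    case 0
    \<comment> \<open>For transient i the start alone already counts 1; the drift condition with a
      nonnegative mean gives f i \<ge> \<delta>, which covers it.\<close>
    have "0 \<le> (\<Sum>j\<in>V. P i j * f j)"
      using 0 f P_nonneg by (intro sum_nonneg mult_nonneg_nonneg) auto
    then show ?case
      using drift[OF 0] \<delta> f(1)[of i] by (cases "recurrent V E i") (auto simp: transient_time_def)
  next
    case (Suc T)
    show ?case
    proof (cases "recurrent V E i")
      case True
      then show ?thesis using f(1)[of i] \<delta> by (simp add: transient_time_def)
    next
      case False
      then have tt: "transient_time (i # xs) = Suc (transient_time xs)" for xs
        by (simp add: transient_time_def)
      have "(\<Sum>xs\<in>seqs V (Suc T). chain_prob P i xs * real (transient_time (i # xs)))
          = (\<Sum>j\<in>V. P i j * (\<Sum>zs\<in>seqs V T. chain_prob P j zs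
              + chain_prob P j zs * real (transient_time (j # zs))))"
        unfolding sum_seqs_Suc tt by (simp add: sum_distrib_left algebra_simps)
      also have "\<dots> \<le> (\<Sum>j\<in>V. P i j * (1 + f j / \<delta>))"
        using Suc P_nonneg
        by (intro sum_mono mult_left_mono) (auto simp: sum.distrib chain_prob_sum)
      also have "\<dots> = 1 + (\<Sum>j\<in>V. P i j * f j) / \<delta>"
        by (simp add: distrib_left sum.distrib P_sum Suc.prems sum_divide_distrib)
      also have "\<dots> \<le> 1 + (f i - \<delta>) / \<delta>"
        using drift[of i] Suc.prems False \<delta> by (simp add: divide_right_mono)
      also have "\<dots> = f i / \<delta>" using \<delta> by (simp add: field_simps)
      finally show ?thesis .
    qed
  qed
  have "(\<Sum>xs\<in>seqs V T. path_prob P mu xs * real (transient_time xs)) \<le> 1 / \<delta>" for T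
  proof (cases T)
    case 0
    then show ?thesis using \<delta> by (simp add: transient_time_def)
  next
    case (Suc T')
    have "(\<Sum>xs\<in>seqs V T. path_prob P mu xs * real (transient_time xs))
        = (\<Sum>i\<in>V. mu i * (\<Sum>xs\<in>seqs V T'. chain_prob P i xs * real (transient_time (i # xs))))"
      unfolding Suc sum_seqs_Suc by (simp add: sum_distrib_left mult.assoc)
    also have "\<dots> \<le> (\<Sum>i\<in>V. mu i * (1 / \<delta>))"
    proof (intro sum_mono mult_left_mono)
      fix i assume i: "i \<in> V"
      show "(\<Sum>xs\<in>seqs V T'. chain_prob P i xs * real (transient_time (i # xs))) \<le> 1 / \<delta>"
        using 1[OF i, of T'] f(2)[of i] \<delta> by (meson divide_right_mono less_imp_le order_trans)
    qed (use mu_pos less_imp_le in blast)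
    also have "\<dots> = 1 / \<delta>" by (simp only: sum_distrib_right[symmetric] mu_sum)
    finally show ?thesis .
  qed
  then show thesis by (rule that)
qed

lemma path_prob_pos_edge:
  assumes "set xs \<subseteq> V" "0 < path_prob P mu xs" "Suc n < length xs"
  shows "(xs ! n, xs ! Suc n) \<in> E"
proof (cases xs)
  case (Cons x xs')
  have "0 < chain_prob P x xs'"
    using assms mu_pos[of x] chain_prob_nonneg[of x xs'] by (auto simp: Cons zero_less_mult_iff)
  then show ?thesis using assms chain_prob_pos_iff[of x xs'] by (auto simp: Cons)
qed (use assms in simp)

text \<open>The nodes accessible from the first entry are closed under edges, so the walk cannot
  leave them.\<close>

lemma walk_in_recurrent_class:
  assumes "zs \<noteq> []" and edge: "\<And>n. Suc n < length zs \<Longrightarrow> (zs ! n, zs ! Suc n) \<in> E"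
    and "C = recurrent_class E (hd zs)"
  shows "zs \<in> walks C (E \<inter> (C \<times> C)) l (map l zs)"
proof -
  have C: "zs ! n \<in> C" if "n < length zs" for n
    using that
  proof (induction n)
    case 0
    then show ?case using assms by (simp add: hd_conv_nth recurrent_class_def accessible_def)
  next
    case (Suc n)
    then show ?case using edge[of n] assms(3)
      by (auto simp: recurrent_class_def accessible_def intro: rtrancl_into_rtrancl)
  qed
  then have "set zs \<subseteq> C" by (auto simp: in_set_conv_nth)
  then show ?thesis using C edge by (auto simp: walks_def)
qed

text \<open>Cut at time s: the prefix is one of card V ^ s words, and the rest, if nonempty, starts
  at a recurrent node and stays in its class, hence is a walk there with prescribed colors. Summing
  over recurrent nodes rather than classes may overcount but needs no representatives.\<close>

lemma card_fiber_le:
  assumes "xs0 \<in> seqs V T"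
  shows "card {xs \<in> seqs V T. map l xs = map l xs0 \<and> path_prob P mu xs > 0 \<and> transient_time xs = s}
    \<le> card V ^ s * (\<Sum>r | recurrent V E r. n_G (recurrent_class E r)
        (E \<inter> (recurrent_class E r \<times> recurrent_class E r)) l Phi (T - s))"
proof -
  define R where "R = {r. recurrent V E r}"
  define W where "W = (\<lambda>r. walks (recurrent_class E r)
        (E \<inter> (recurrent_class E r \<times> recurrent_class E r)) l (drop s (map l xs0)))"
  define X where "X = {xs \<in> seqs V T. map l xs = map l xs0 \<and> path_prob P mu xs > 0
    \<and> transient_time xs = s}"
  have RV: "R \<subseteq> V" by (auto simp: R_def recurrent_def)
  have finR: "finite R" using RV finV by (rule finite_subset)
  have CV: "recurrent_class E r \<subseteq> V" if "r \<in> R" for r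
    using that RV accessible_in_V by (auto simp: recurrent_class_def)
  have finW: "finite (W r)" if "r \<in> R" for r
    unfolding W_def using CV[OF that] finV by (intro finite_walks) (rule finite_subset)
  have "drop s xs \<in> (\<Union>r\<in>R. W r)" if "xs \<in> X" for xs
  proof -
    have xs: "xs \<in> seqs V T" "map l xs = map l xs0" "path_prob P mu xs > 0"
      and s: "transient_time xs = s" using that by (auto simp: X_def)
    have dw: "drop s xs = dropWhile (\<lambda>i. \<not> recurrent V E i) xs"
      using s by (simp add: transient_time_def dropWhile_eq_drop)
    have ys: "drop s (map l xs0) = map l (drop s xs)" using xs(2) by (metis drop_map)
    show ?thesis
    proof (cases "drop s xs = []")
      case True
      \<comment> \<open>No recurrent node is met; the empty rest is a walk in any class, and some
        recurrent node exists.\<close>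
      obtain i where "i \<in> V" using V_nonempty by blast
      then obtain r where "r \<in> R" using reaches_recurrent unfolding R_def by blast
      moreover have "drop s xs \<in> W r" unfolding W_def ys using True by (simp add: walks_def)
      ultimately show ?thesis by blast
    next
      case False
      then have r: "hd (drop s xs) \<in> R"
        unfolding dw R_def using hd_dropWhile[of "\<lambda>i. \<not> recurrent V E i" xs] by simp
      have "drop s xs \<in> W (hd (drop s xs))"
        unfolding W_def ys
      proof (rule walk_in_recurrent_class[OF False _ refl])
        fix n assume "Suc n < length (drop s xs)"
        then show "(drop s xs ! n, drop s xs ! Suc n) \<in> E"
          using path_prob_pos_edge[of xs "s + n"] xs by (simp add: seqs_def)
      qed
      with r show ?thesis by blast
    qed
  qed
  moreover have "take s xs \<in> seqs V s" if "xs \<in> X" for xs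
    using that transient_time_le[of xs] set_take_subset[of s xs] by (auto simp: X_def seqs_def)
  ultimately have "(\<lambda>xs. (take s xs, drop s xs)) ` X \<subseteq> seqs V s \<times> (\<Union>r\<in>R. W r)"
    by blast
  moreover have "inj_on (\<lambda>xs. (take s xs, drop s xs)) X"
    by (rule inj_onI) (metis Pair_inject append_take_drop_id)
  ultimately have "card X \<le> card (seqs V s \<times> (\<Union>r\<in>R. W r))"
    using finR finW by (intro card_inj_on_le) auto
  also have "\<dots> \<le> card V ^ s * (\<Sum>r\<in>R. card (W r))"
    using finR by (simp add: card_cartesian_product card_seqs card_UN_le)
  also have "\<dots> \<le> card V ^ s * (\<Sum>r\<in>R. n_G (recurrent_class E r)
        (E \<inter> (recurrent_class E r \<times> recurrent_class E r)) l Phi (T - s))"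
  proof (intro mult_left_mono sum_mono)
    fix r
    have "set (drop s (map l xs0)) \<subseteq> Phi"
      using assms lV set_drop_subset[of s "map l xs0"] by (fastforce simp: seqs_def)
    then have "card (W r) \<le> n_G (recurrent_class E r)
        (E \<inter> (recurrent_class E r \<times> recurrent_class E r)) l Phi (length (drop s (map l xs0)))"
      unfolding W_def by (rule card_walks_le_n_G[OF finPhi])
    then show "card (W r) \<le> n_G (recurrent_class E r)
        (E \<inter> (recurrent_class E r \<times> recurrent_class E r)) l Phi (T - s)"
      using assms by (simp add: seqs_def)
  qed simp
  finally show ?thesis by (simp add: X_def R_def)
qed

text \<open>The sum of the finitely many exponents serves as a common exponent. The extra 1 in the
  constant keeps \<open>D\<close> positive, since its logarithm is taken later.\<close>

lemma trackable_classes_bound: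
  assumes "\<And>r. recurrent V E r \<Longrightarrow> trackable (recurrent_class E r)
      (E \<inter> (recurrent_class E r \<times> recurrent_class E r)) l Phi"
  obtains D k where "D \<ge> 1" "\<And>t. (\<Sum>r | recurrent V E r. real (n_G (recurrent_class E r)
        (E \<inter> (recurrent_class E r \<times> recurrent_class E r)) l Phi t)) \<le> D * real (Suc t) ^ k"
proof -
  define R where "R = {r. recurrent V E r}"
  define n where "n = (\<lambda>r. n_G (recurrent_class E r)
        (E \<inter> (recurrent_class E r \<times> recurrent_class E r)) l Phi)"
  have finR: "finite R" by (rule finite_subset[OF _ finV]) (auto simp: R_def recurrent_def)
  have "\<forall>r\<in>R. \<exists>c k. c \<ge> 0 \<and> (\<forall>t. real (n r t) \<le> c * real (Suc t) ^ k)"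
    using trackable_bound[OF assms] unfolding R_def n_def by (metis mem_Collect_eq)
  then obtain c k where ck: "\<And>r. r \<in> R \<Longrightarrow> c r \<ge> 0"
    "\<And>r t. r \<in> R \<Longrightarrow> real (n r t) \<le> c r * real (Suc t) ^ k r"
    by metis
  define K where "K = (\<Sum>r\<in>R. k r)"
  have "(\<Sum>r\<in>R. real (n r t)) \<le> (1 + (\<Sum>r\<in>R. c r)) * real (Suc t) ^ K" for t
  proof -
    have "(\<Sum>r\<in>R. real (n r t)) \<le> (\<Sum>r\<in>R. c r * real (Suc t) ^ K)"
    proof (rule sum_mono)
      fix r assume r: "r \<in> R"
      have "k r \<le> K" unfolding K_def using r finR by (intro member_le_sum) auto
      then have "c r * real (Suc t) ^ k r \<le> c r * real (Suc t) ^ K"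
        using ck(1)[OF r] by (intro mult_left_mono power_increasing) auto
      then show "real (n r t) \<le> c r * real (Suc t) ^ K" using ck(2)[OF r, of t] by linarith
    qed
    also have "\<dots> \<le> (1 + (\<Sum>r\<in>R. c r)) * real (Suc t) ^ K"
      by (simp add: sum_distrib_right distrib_right)
    finally show ?thesis .
  qed
  moreover have "1 + (\<Sum>r\<in>R. c r) \<ge> 1" using ck(1) by (simp add: sum_nonneg)
  ultimately show thesis using that unfolding R_def n_def by blast
qed

text \<open>The code \<open>q\<close> pays log (T + 1) for the value of the transient time, log
  (card V) per transient entry, and log M for the walk inside the class. As the expected transient
  time is bounded, only a logarithm in T remains.\<close>

lemma trackable_classes_entropy_bound:
  assumes "\<And>r. recurrent V E r \<Longrightarrow> trackable (recurrent_class E r)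
      (E \<inter> (recurrent_class E r \<times> recurrent_class E r)) l Phi"
  obtains A B where "\<And>T. cond_entropy V l P mu T \<le> A * log 2 (real T + 1) + B"
proof -
  obtain D k where D: "D \<ge> 1" and bound: "\<And>t. (\<Sum>r | recurrent V E r. real (n_G
      (recurrent_class E r) (E \<inter> (recurrent_class E r \<times> recurrent_class E r)) l Phi t))
      \<le> D * real (Suc t) ^ k"
    using trackable_classes_bound[OF assms] by blast
  obtain B where B: "\<And>T. (\<Sum>xs\<in>seqs V T. path_prob P mu xs * real (transient_time xs)) \<le> B"
    using expected_transient_time by blast
  define n where "n = real (card V)"
  have n1: "n \<ge> 1" using V_nonempty by (simp add: n_def Suc_le_eq card_gt_0_iff)
  have "cond_entropy V l P mu T \<le> (real k + 1) * log 2 (real T + 1) + (log 2 D + log 2 n * B)" for T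
  proof -
    define M where "M = D * real (Suc T) ^ k"
    define q where "q = (\<lambda>xs. 1 / (real (Suc T) * (n ^ transient_time xs * M)))"
    have M0: "M > 0" using D by (simp add: M_def)
    have "cond_entropy V l P mu T \<le> (\<Sum>xs\<in>seqs V T. path_prob P mu xs * - log 2 (q xs))"
    proof (rule cond_entropy_le)
      fix xs0 assume xs0: "xs0 \<in> seqs V T"
      define F where "F = {xs. xs \<in> seqs V T \<and> map l xs = map l xs0 \<and> path_prob P mu xs > 0}"
      have finF: "finite F" by (rule finite_subset[OF _ finite_seqs[OF finV, of T]]) (auto simp: F_def)
      \<comment> \<open>Split by the transient time: each of its T + 1 possible values receives mass
        at most 1 / (T + 1).\<close>
      have "(\<Sum>xs\<in>F. q xs) = (\<Sum>s\<le>T. \<Sum>xs | xs \<in> F \<and> transient_time xs = s. q xs)"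
        using finF transient_time_le by (subst sum.group) (fastforce simp: F_def seqs_def)+
      also have "\<dots> \<le> (\<Sum>s\<le>T. 1 / real (Suc T))"
      proof (rule sum_mono)
        fix s assume "s \<in> {..T}"
        have "real (card {xs. xs \<in> F \<and> transient_time xs = s}) \<le>
            real (card V ^ s * (\<Sum>r | recurrent V E r. n_G (recurrent_class E r)
              (E \<inter> (recurrent_class E r \<times> recurrent_class E r)) l Phi (T - s)))"
          using card_fiber_le[OF xs0, of s] unfolding of_nat_le_iff F_def
          by (simp add: conj_ac)
        also have "\<dots> \<le> n ^ s * (D * real (Suc (T - s)) ^ k)"
          using bound[of "T - s"] n1 by (simp add: n_def mult_left_mono)
        \<comment> \<open>Enlarging T - s to T makes the bound \<open>M\<close> independent of
          s.\<close>
        also have "\<dots> \<le> n ^ s * M"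
          unfolding M_def using D n1 by (intro mult_left_mono power_mono) auto
        finally have c: "real (card {xs. xs \<in> F \<and> transient_time xs = s}) \<le> n ^ s * M" .
        have "(\<Sum>xs | xs \<in> F \<and> transient_time xs = s. q xs)
            = (\<Sum>xs | xs \<in> F \<and> transient_time xs = s. 1 / (real (Suc T) * (n ^ s * M)))"
          by (rule sum.cong) (auto simp: q_def)
        also have "\<dots> = real (card {xs. xs \<in> F \<and> transient_time xs = s}) / (n ^ s * M)
            / real (Suc T)"
          by simp
        also have "\<dots> \<le> 1 / real (Suc T)"
          using c n1 M0 by (intro divide_right_mono) auto
        finally show "(\<Sum>xs | xs \<in> F \<and> transient_time xs = s. q xs) \<le> 1 / real (Suc T)" .
      qed
      also have "\<dots> = 1" by simp
      finally show "(\<Sum>xs' | xs' \<in> seqs V T \<and> map l xs' = map l xs0 \<and> path_prob P mu xs' > 0. q xs') \<le> 1"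
        by (simp add: F_def)
    qed (use n1 M0 in \<open>auto simp: q_def\<close>)
    also have "\<dots> = (\<Sum>xs\<in>seqs V T. path_prob P mu xs * (log 2 (real (Suc T)) + log 2 M)
        + log 2 n * (path_prob P mu xs * real (transient_time xs)))"
    proof (rule sum.cong[OF refl])
      fix xs
      have "- log 2 (q xs) = log 2 (real (Suc T)) + (real (transient_time xs) * log 2 n + log 2 M)"
        using n1 M0 unfolding q_def by (simp add: log_divide log_mult log_nat_power)
      then show "path_prob P mu xs * - log 2 (q xs) =
          path_prob P mu xs * (log 2 (real (Suc T)) + log 2 M)
          + log 2 n * (path_prob P mu xs * real (transient_time xs))"
        by (simp add: algebra_simps)
    qed
    also have "\<dots> = (log 2 (real (Suc T)) + log 2 M)
        + log 2 n * (\<Sum>xs\<in>seqs V T. path_prob P mu xs * real (transient_time xs))"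
      by (simp add: sum.distrib sum_distrib_left[symmetric] sum_distrib_right[symmetric] path_prob_sum)
    also have "\<dots> \<le> (log 2 (real (Suc T)) + log 2 M) + log 2 n * B"
      using B[of T] n1 by (intro add_left_mono mult_left_mono) auto
    also have "log 2 M = log 2 D + real k * log 2 (real T + 1)"
      using D by (simp add: M_def log_mult log_nat_power add.commute)
    finally show ?thesis by (simp add: algebra_simps)
  qed
  then show thesis by (rule that)
qed

lemma trackable_classes_imp_rate_zero:
  assumes "\<And>r. recurrent V E r \<Longrightarrow> trackable (recurrent_class E r)
      (E \<inter> (recurrent_class E r \<times> recurrent_class E r)) l Phi"
  shows "cond_entropy_rate V l P mu = 0"
proof -
  obtain A B where AB: "\<And>T. cond_entropy V l P mu T \<le> A * log 2 (real T + 1) + B"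
    using trackable_classes_entropy_bound[OF assms] by blast
  have "(\<lambda>T. cond_entropy V l P mu T / real T) \<longlonglongrightarrow> 0"
  proof (rule tendsto_sandwich)
    show "\<forall>\<^sub>F T in sequentially. 0 \<le> cond_entropy V l P mu T / real T"
      by (simp add: cond_entropy_nonneg)
    show "\<forall>\<^sub>F T in sequentially. cond_entropy V l P mu T / real T
        \<le> (A * log 2 (real T + 1) + B) / real T"
      using AB by (intro always_eventually allI divide_right_mono) auto
    show "(\<lambda>T. (A * log 2 (real T + 1) + B) / real T) \<longlonglongrightarrow> 0"
      by real_asymp
  qed simp
  then have "(\<lambda>T. ereal (cond_entropy V l P mu T / real T)) \<longlonglongrightarrow> ereal 0"
    by simp
  then show ?thesis
    unfolding cond_entropy_rate_def zero_ereal_def by (intro lim_imp_Limsup) auto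
qed


section \<open>Untrackable recurrent classes: lower bound\<close>

text \<open>The start i is given and not part of the sequence, so \<open>ys\<close> holds the colors
  of the later states only.\<close>

definition obs_from :: "'v \<Rightarrow> 'c list \<Rightarrow> real" where
  "obs_from i ys = (\<Sum>xs | xs \<in> seqs V (length ys) \<and> map l xs = ys. chain_prob P i xs)"

text \<open>This is the conditional entropy of the next T states given their colors and the current
  state i; the quotient is inverted so that every summand is nonnegative.\<close>

definition entropy_from :: "'v \<Rightarrow> nat \<Rightarrow> real" where
  "entropy_from i T =
     (\<Sum>xs\<in>seqs V T. chain_prob P i xs * log 2 (obs_from i (map l xs) / chain_prob P i xs))"

text \<open>Continuations of the words in W are distinct paths with the same observation, so their
  probabilities add up. Taking two confusable loops for W is how the ambiguity enters.\<close>

lemma obs_from_append: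
  assumes "i \<in> V" "W \<subseteq> {ws \<in> seqs V (length us). map l ws = us}"
    and "\<And>ws. ws \<in> W \<Longrightarrow> last (i # ws) = j"
  shows "(\<Sum>ws\<in>W. chain_prob P i ws) * obs_from j ys \<le> obs_from i (us @ ys)"
proof -
  define Z where "Z = {zs. zs \<in> seqs V (length ys) \<and> map l zs = ys}"
  have inj: "inj_on (\<lambda>(ws, zs). ws @ zs) (W \<times> Z)"
  proof (rule inj_onI)
    fix x y assume "x \<in> W \<times> Z" "y \<in> W \<times> Z"
      "(case x of (ws, zs) \<Rightarrow> ws @ zs) = (case y of (ws, zs) \<Rightarrow> ws @ zs)"
    moreover have "length (fst x) = length us" "length (fst y) = length us"
      using calculation assms(2) by (auto simp: seqs_def)
    ultimately show "x = y" by (cases x, cases y) simp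
  qed
  have "(\<Sum>ws\<in>W. chain_prob P i ws) * obs_from j ys
      = (\<Sum>(ws, zs)\<in>W \<times> Z. chain_prob P i ws * chain_prob P j zs)"
    by (simp add: obs_from_def Z_def sum_product sum.cartesian_product)
  also have "\<dots> = (\<Sum>x\<in>W \<times> Z. chain_prob P i (case x of (ws, zs) \<Rightarrow> ws @ zs))"
    using assms(3) by (intro sum.cong) (auto simp: chain_prob_append)
  also have "\<dots> = sum (chain_prob P i) ((\<lambda>(ws, zs). ws @ zs) ` (W \<times> Z))"
    using inj by (simp add: sum.reindex)
  also have "\<dots> \<le> obs_from i (us @ ys)"
    unfolding obs_from_def
  proof (rule sum_mono2)
    show "finite {xs. xs \<in> seqs V (length (us @ ys)) \<and> map l xs = us @ ys}" by simp
    show "(\<lambda>(ws, zs). ws @ zs) ` (W \<times> Z) \<subseteq> {xs. xs \<in> seqs V (length (us @ ys)) \<and> map l xs = us @ ys}"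
      using subsetD[OF assms(2)] by (force simp: seqs_def Z_def)
  qed (use assms(1) chain_prob_nonneg in \<open>auto simp: seqs_def\<close>)
  finally show ?thesis .
qed

lemma obs_from_append_seq:
  assumes "i \<in> V" "ws \<in> seqs V L"
  shows "chain_prob P i ws * obs_from (last (i # ws)) (map l zs) \<le> obs_from i (map l (ws @ zs))"
  using obs_from_append[of i "{ws}" "map l ws" "last (i # ws)" "map l zs"] assms
  by (simp add: seqs_def)

lemma chain_prob_le_obs_from:
  assumes "i \<in> V" "xs \<in> seqs V T"
  shows "chain_prob P i xs \<le> obs_from i (map l xs)"
  using obs_from_append_seq[OF assms, of "[]"] by (simp add: obs_from_def)

lemma entropy_from_nonneg:
  assumes "i \<in> V"
  shows "0 \<le> entropy_from i T"
  unfolding entropy_from_def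
proof (rule sum_nonneg)
  fix xs assume xs: "xs \<in> seqs V T"
  show "0 \<le> chain_prob P i xs * log 2 (obs_from i (map l xs) / chain_prob P i xs)"
  proof (cases "chain_prob P i xs = 0")
    case False
    then have "chain_prob P i xs > 0"
      using chain_prob_nonneg[of i xs] xs assms by (simp add: seqs_def)
    then show ?thesis using chain_prob_le_obs_from[OF assms xs] by simp
  qed simp
qed

text \<open>The chain rule with the first $L$ steps split off; the factors $c$ record the ambiguity
  of these steps.\<close>

lemma entropy_from_step:
  assumes i: "i \<in> V"
    and c: "\<And>ws. ws \<in> seqs V L \<Longrightarrow> c ws > 0"
      "\<And>ws zs. ws \<in> seqs V L \<Longrightarrow> zs \<in> seqs V T \<Longrightarrow>
        c ws * chain_prob P i ws * obs_from (last (i # ws)) (map l zs) \<le> obs_from i (map l (ws @ zs))"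
  shows "(\<Sum>ws\<in>seqs V L. chain_prob P i ws * (log 2 (c ws) + entropy_from (last (i # ws)) T))
    \<le> entropy_from i (L + T)"
  unfolding entropy_from_def[of i] sum_seqs_append
proof (rule sum_mono)
  fix ws assume ws: "ws \<in> seqs V L"
  define j where "j = last (i # ws)"
  have j: "j \<in> V" using ws i by (auto simp: j_def seqs_def)
  \<comment> \<open>The continuations from j have total mass 1, which lets log (c ws) move inside
    the sum.\<close>
  have "chain_prob P i ws * (log 2 (c ws) + entropy_from j T)
      = (\<Sum>zs\<in>seqs V T. chain_prob P i ws * (chain_prob P j zs *
          (log 2 (c ws) + log 2 (obs_from j (map l zs) / chain_prob P j zs))))"
    unfolding entropy_from_def sum_distrib_left[symmetric]
    by (simp add: distrib_left sum.distrib sum_distrib_right[symmetric] chain_prob_sum[OF j])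
  also have "\<dots> \<le> (\<Sum>zs\<in>seqs V T. chain_prob P i (ws @ zs) *
        log 2 (obs_from i (map l (ws @ zs)) / chain_prob P i (ws @ zs)))"
  proof (rule sum_mono)
    fix zs assume zs: "zs \<in> seqs V T"
    define p where "p = chain_prob P i ws"
    define r where "r = chain_prob P j zs"
    have pr: "chain_prob P i (ws @ zs) = p * r" by (simp add: chain_prob_append p_def r_def j_def)
    have "p \<ge> 0" "r \<ge> 0"
      using chain_prob_nonneg i j ws zs by (auto simp: p_def r_def seqs_def)
    then consider "p * r = 0" | "p > 0" "r > 0" by fastforce
    then show "p * (r * (log 2 (c ws) + log 2 (obs_from j (map l zs) / r))) \<le>
        chain_prob P i (ws @ zs) * log 2 (obs_from i (map l (ws @ zs)) / chain_prob P i (ws @ zs))"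
    proof cases
      case 1
      then show ?thesis by (auto simp: pr)
    next
      case 2
      have ob: "obs_from j (map l zs) > 0"
        using chain_prob_le_obs_from[OF j zs] 2 by (simp add: r_def)
      have "log 2 (c ws) + log 2 (obs_from j (map l zs) / r)
          = log 2 (c ws * (obs_from j (map l zs) / r))"
        using c(1)[OF ws] ob 2 by (simp add: log_mult log_divide)
      also have "c ws * (obs_from j (map l zs) / r)
          = c ws * p * obs_from j (map l zs) / (p * r)"
        using 2 by simp
      also have "log 2 \<dots> \<le> log 2 (obs_from i (map l (ws @ zs)) / (p * r))"
      proof -
        have le: "c ws * p * obs_from j (map l zs) \<le> obs_from i (map l (ws @ zs))"
          using c(2)[OF ws zs] by (simp add: p_def j_def)
        have "0 < c ws * p * obs_from j (map l zs) / (p * r)" using c(1)[OF ws] ob 2 by simp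
        then show ?thesis using le 2 by (intro log_mono divide_right_mono) auto
      qed
      finally show ?thesis using 2 by (simp add: pr mult.assoc)
    qed
  qed
  finally show "chain_prob P i ws * (log 2 (c ws) + entropy_from (last (i # ws)) T)
      \<le> (\<Sum>zs\<in>seqs V T. chain_prob P i (ws @ zs) *
        log 2 (obs_from i (map l (ws @ zs)) / chain_prob P i (ws @ zs)))"
    by (simp add: j_def)
qed

text \<open>Strong induction on T with the potential f proves the bound
  \<open>lk * (\<alpha> * T - \<beta> * f i - \<alpha> * L)\<close> on the class. Away from v one
  step is taken, and its price \<alpha> is paid by the drift \<beta> * \<delta>. At v, L steps are
  taken; with probability \<open>pa\<close> they follow a and gain \<open>lk\<close>, which pays
  \<alpha> * L and \<beta> times the rise of f from f v = 0 to at most 1.\<close>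

lemma entropy_from_linear:
  assumes v: "recurrent V E v"
    and a: "a \<in> seqs V L" "chain_prob P v a > 0" "last (v # a) = v"
    and b: "b \<in> seqs V L" "chain_prob P v b > 0" "last (v # b) = v"
    and ab: "a \<noteq> b" "map l a = map l b"
  obtains \<alpha> \<gamma> where "\<alpha> > 0" "\<And>T. \<alpha> * real T - \<gamma> \<le> entropy_from v T"
proof -
  define C where "C = recurrent_class E v"
  have vV: "v \<in> V" using v by (simp add: recurrent_def)
  have CV: "C \<subseteq> V" using vV accessible_in_V by (auto simp: C_def recurrent_class_def)
  have vC: "v \<in> C" by (simp add: C_def recurrent_class_def accessible_def)
  have closed: "j \<in> C" if "i \<in> C" "(i, j) \<in> E\<^sup>*" for i j
    using that by (auto simp: C_def recurrent_class_def accessible_def intro: rtrancl_trans)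
  have reach: "\<exists>r\<in>{v}. (i, r) \<in> E\<^sup>*" if "i \<in> C" for i
    using that v by (auto simp: C_def recurrent_class_def accessible_def recurrent_def)
  obtain f \<delta> where \<delta>: "\<delta> > 0" and f: "\<And>i. 0 \<le> f i" "\<And>i. f i \<le> 1"
    and fv: "\<And>i. i \<in> {v} \<Longrightarrow> f i = 0"
    and drift: "\<And>i. i \<in> C \<Longrightarrow> i \<notin> {v} \<Longrightarrow> (\<Sum>j\<in>V. P i j * f j) \<le> f i - \<delta>"
    by (rule drift_function[OF CV reach], assumption) (rule that)
  define pa where "pa = chain_prob P v a"
  \<comment> \<open>K times the probability of a is the joint probability of a and b. Only a is
    credited with this ambiguity; every other word gets the factor 1.\<close>
  define K where "K = 1 + chain_prob P v b / pa"
  define lk where "lk = log 2 K"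
  have pa: "pa > 0" using a by (simp add: pa_def)
  have K1: "K > 1" using pa b by (simp add: K_def)
  then have lk: "lk > 0" by (simp add: lk_def)
  \<comment> \<open>Solves pa = \<alpha> * L + \<beta> with \<alpha> = \<beta> * \<delta>.\<close>
  define \<beta> where "\<beta> = pa / (\<delta> * real L + 1)"
  define \<alpha> where "\<alpha> = \<beta> * \<delta>"
  have den: "\<delta> * real L + 1 > 0" using \<delta> by (simp add: add_nonneg_pos)
  have \<beta>: "\<beta> > 0" using pa den by (simp add: \<beta>_def)
  have \<alpha>: "\<alpha> > 0" using \<beta> \<delta> by (simp add: \<alpha>_def)
  have pa_eq: "pa = \<alpha> * real L + \<beta>"
  proof -
    have "\<alpha> * real L + \<beta> = \<beta> * (\<delta> * real L + 1)" by (simp add: \<alpha>_def algebra_simps)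
    also have "\<dots> = pa" using den by (simp add: \<beta>_def)
    finally show ?thesis by simp
  qed
  \<comment> \<open>Distinct words of equal length are nonempty; hence the L steps at v shorten T,
    as the induction requires.\<close>
  have L: "L \<ge> 1" using a b ab by (cases L) auto
  have main: "lk * (\<alpha> * real T - \<beta> * f i - \<alpha> * real L) \<le> entropy_from i T" if "i \<in> C" for i T
    using that
  proof (induction T arbitrary: i rule: less_induct)
    case (less T)
    have iV: "i \<in> V" using less.prems CV by auto
    have stay: "last (i # ws) \<in> C" if "ws \<in> seqs V M" "chain_prob P i ws > 0" for ws M
      using closed[OF less.prems] chain_prob_pos_last[OF iV] that by (simp add: seqs_def)
    have \<beta>f: "0 \<le> \<beta> * f i" using \<beta> f by simp
    \<comment> \<open>For T < L no loop fits, and the offset \<alpha> * L makes the bound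
      nonpositive.\<close>
    have trivial: ?case if "T < L"
    proof -
      have "\<alpha> * real T \<le> \<alpha> * real L" using that \<alpha> by simp
      then have "lk * (\<alpha> * real T - \<beta> * f i - \<alpha> * real L) \<le> 0"
        using lk \<beta>f by (intro mult_nonneg_nonpos) auto
      then show ?thesis using entropy_from_nonneg[OF iV, of T] by linarith
    qed
    show ?case
    proof (cases "i = v")
      case False
      show ?thesis
      proof (cases T)
        case 0
        then show ?thesis using trivial L by simp
      next
        case (Suc T')
        define X where "X = \<alpha> * real T' - \<alpha> * real L"
        have "lk * (X - \<beta> * (\<Sum>j\<in>V. P i j * f j)) = (\<Sum>j\<in>V. P i j * (lk * (X - \<beta> * f j)))"
        proof -
          have "(\<Sum>j\<in>V. P i j * (lk * (X - \<beta> * f j)))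
              = (\<Sum>j\<in>V. P i j * (lk * X) - lk * \<beta> * (P i j * f j))"
            by (simp add: algebra_simps)
          also have "\<dots> = lk * X - lk * \<beta> * (\<Sum>j\<in>V. P i j * f j)"
            by (simp add: sum_subtractf sum_distrib_left[symmetric] sum_distrib_right[symmetric]
                P_sum[OF iV])
          finally show ?thesis by (simp add: algebra_simps)
        qed
        also have "\<dots> \<le> (\<Sum>j\<in>V. P i j * entropy_from j T')"
        proof (rule sum_mono)
          fix j assume j: "j \<in> V"
          show "P i j * (lk * (X - \<beta> * f j)) \<le> P i j * entropy_from j T'"
          proof (cases "P i j = 0")
            case False
            then have "P i j > 0" using P_nonneg[OF iV j] by simp
            then have "j \<in> C" using closed[OF less.prems] P_pos_iff[OF iV j] by blast
            then have "lk * (\<alpha> * real T' - \<beta> * f j - \<alpha> * real L) \<le> entropy_from j T'"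
              using less.IH Suc by simp
            then show ?thesis
              using \<open>P i j > 0\<close> unfolding X_def by (intro mult_left_mono) (auto simp: algebra_simps)
          qed simp
        qed
        \<comment> \<open>A single step claims no ambiguity: the chain rule is applied with L = 1
          and c = 1.\<close>
        also have "\<dots> = (\<Sum>ws\<in>seqs V 1. chain_prob P i ws *
            (log 2 1 + entropy_from (last (i # ws)) T'))"
          unfolding sum_seqs_1 by simp
        also have "\<dots> \<le> entropy_from i (1 + T')"
          using iV by (intro entropy_from_step)
            (auto simp del: map_append last.simps intro: obs_from_append_seq)
        finally have 1: "lk * (X - \<beta> * (\<Sum>j\<in>V. P i j * f j)) \<le> entropy_from i T" by (simp add: Suc)
        have "\<beta> * (\<Sum>j\<in>V. P i j * f j) \<le> \<beta> * (f i - \<delta>)"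
          using drift[OF less.prems] False \<beta> by (intro mult_left_mono) auto
        then have "\<alpha> * real T - \<beta> * f i - \<alpha> * real L \<le> X - \<beta> * (\<Sum>j\<in>V. P i j * f j)"
          by (simp add: X_def Suc \<alpha>_def algebra_simps)
        then have "lk * (\<alpha> * real T - \<beta> * f i - \<alpha> * real L)
            \<le> lk * (X - \<beta> * (\<Sum>j\<in>V. P i j * f j))"
          using lk by (intro mult_left_mono) auto
        with 1 show ?thesis by linarith
      qed
    next
      case True
      show ?thesis
      proof (cases "T < L")
        case False
        define T' where "T' = T - L"
        have T: "T = L + T'" using False by (simp add: T'_def)
        define c where "c = (\<lambda>ws. if ws = a then K else 1)"
        \<comment> \<open>The induction hypothesis at the unknown end of the L steps, with f
          replaced by its upper bound 1.\<close>
        define X where "X = lk * (\<alpha> * real T' - \<beta> - \<alpha> * real L)"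
        have "lk * (\<alpha> * real T - \<beta> * f i - \<alpha> * real L) = pa * lk + X"
          using True fv[of v] by (simp add: T X_def pa_eq algebra_simps)
        also have "\<dots> = (\<Sum>ws\<in>seqs V L. (if ws = a then pa * lk else 0) + chain_prob P v ws * X)"
          using a by (simp add: sum.distrib sum_distrib_right[symmetric] chain_prob_sum[OF vV])
        also have "\<dots> \<le> (\<Sum>ws\<in>seqs V L. chain_prob P v ws *
            (log 2 (c ws) + entropy_from (last (v # ws)) T'))"
        proof (rule sum_mono)
          fix ws assume ws: "ws \<in> seqs V L"
          have "chain_prob P v ws * X \<le> chain_prob P v ws * entropy_from (last (v # ws)) T'"
          proof (cases "chain_prob P v ws = 0")
            case nz: False
            then have pos: "chain_prob P v ws > 0"
              using chain_prob_nonneg[OF vV, of ws] ws by (simp add: seqs_def)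
            define j where "j = last (v # ws)"
            have j: "j \<in> C" using stay[OF ws] pos True by (simp add: j_def)
            have "X \<le> lk * (\<alpha> * real T' - \<beta> * f j - \<alpha> * real L)"
              unfolding X_def using lk \<beta> f(2)[of j] by (intro mult_left_mono) auto
            also have "\<dots> \<le> entropy_from j T'" using less.IH[of T' j] L T j by simp
            finally show ?thesis using pos by (simp add: j_def)
          qed simp
          then show "(if ws = a then pa * lk else 0) + chain_prob P v ws * X
              \<le> chain_prob P v ws * (log 2 (c ws) + entropy_from (last (v # ws)) T')"
            by (auto simp: c_def lk_def pa_def distrib_left)
        qed
        also have "\<dots> \<le> entropy_from v (L + T')"
        proof (rule entropy_from_step[OF vV])
          show "c ws > 0" for ws using K1 by (simp add: c_def)
          fix ws zs assume ws: "ws \<in> seqs V L" and zs: "zs \<in> seqs V T'"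
          show "c ws * chain_prob P v ws * obs_from (last (v # ws)) (map l zs)
              \<le> obs_from v (map l (ws @ zs))"
          proof (cases "ws = a")
            case True
            have "K * pa = (\<Sum>ws\<in>{a, b}. chain_prob P v ws)"
              using ab pa by (simp add: K_def pa_def field_simps)
            moreover have "(\<Sum>ws\<in>{a, b}. chain_prob P v ws) * obs_from v (map l zs)
                \<le> obs_from v (map l a @ map l zs)"
              using a b ab by (intro obs_from_append[OF vV]) (auto simp: seqs_def)
            ultimately show ?thesis using True a by (simp add: c_def pa_def)
          next
            case False
            then show ?thesis using obs_from_append_seq[OF vV ws, of zs] by (simp add: c_def)
          qed
        qed
        finally show ?thesis by (simp add: T True)
      qed (use trivial in blast)
    qed
  qed
  have "lk * \<alpha> * real T - lk * (\<alpha> * real L) \<le> entropy_from v T" for T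
    using main[OF vC, of T] fv[of v] by (simp add: algebra_simps)
  moreover have "lk * \<alpha> > 0" using lk \<alpha> by simp
  ultimately show thesis by (rule that[rotated])
qed

section \<open>From a known start to the entropy rate\<close>

text \<open>Revealing the first state can only lower the entropy. That state is v with probability
  \<open>mu v\<close>, and the other starts contribute nonnegative terms.\<close>

lemma cond_entropy_ge:
  assumes v: "v \<in> V"
  shows "mu v * entropy_from v T \<le> cond_entropy V l P mu (Suc T)"
proof -
  have "mu v * entropy_from v T \<le> (\<Sum>x\<in>V. mu x * entropy_from x T)"
    using v mu_pos entropy_from_nonneg
    by (intro member_le_sum) (auto intro!: mult_nonneg_nonneg intro: less_imp_le)
  also have "\<dots> \<le> cond_entropy V l P mu (Suc T)"
    unfolding cond_entropy_def sum_seqs_Suc sum_negf[symmetric] entropy_from_def sum_distrib_left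
  proof (intro sum_mono)
    fix x zs assume x: "x \<in> V" and zs: "zs \<in> seqs V T"
    define p where "p = chain_prob P x zs"
    define Ob where "Ob = obs_prob V l P mu (Suc T) (map l (x # zs))"
    have mx: "mu x > 0" using x by (rule mu_pos)
    have "p \<ge> 0" using chain_prob_nonneg[OF x, of zs] zs by (simp add: p_def seqs_def)
    then consider "p = 0" | "p > 0" by fastforce
    then show "mu x * (chain_prob P x zs * log 2 (obs_from x (map l zs) / chain_prob P x zs)) \<le>
       - (path_prob P mu (x # zs) * log 2 (path_prob P mu (x # zs) /
            obs_prob V l P mu (Suc T) (map l (x # zs))))"
    proof cases
      case 1
      then show ?thesis by (simp add: p_def)
    next
      case 2
      have of: "obs_from x (map l zs) > 0"
        using chain_prob_le_obs_from[OF x zs] 2 by (simp add: p_def)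
      \<comment> \<open>The same observation may also arise from other starts of the same color,
        hence only an inequality.\<close>
      have le: "mu x * obs_from x (map l zs) \<le> Ob"
      proof -
        have "mu x * obs_from x (map l zs)
            = (\<Sum>zs' | zs' \<in> seqs V T \<and> map l zs' = map l zs. path_prob P mu (x # zs'))"
          using zs by (simp add: obs_from_def sum_distrib_left seqs_def)
        also have "\<dots> = sum (path_prob P mu) ((#) x ` {zs'. zs' \<in> seqs V T \<and> map l zs' = map l zs})"
          by (simp add: sum.reindex)
        also have "\<dots> \<le> Ob"
          unfolding Ob_def obs_prob_def
        proof (rule sum_mono2)
          show "finite {xs \<in> seqs V (Suc T). map l xs = map l (x # zs)}" by simp
        qed (use x path_prob_nonneg in \<open>auto simp: seqs_def\<close>)
        finally show ?thesis .
      qed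
      have Ob: "Ob > 0" using le mx of by (meson less_le_trans mult_pos_pos)
      have "obs_from x (map l zs) / p = mu x * obs_from x (map l zs) / (mu x * p)"
        using mx by simp
      also have "\<dots> \<le> Ob / (mu x * p)" using le mx 2 by (intro divide_right_mono) auto
      finally have "log 2 (obs_from x (map l zs) / p) \<le> log 2 (Ob / (mu x * p))"
        using of 2 by (intro log_mono) auto
      also have "\<dots> = - log 2 (mu x * p / Ob)" using mx 2 Ob by (simp add: log_divide)
      finally have "mu x * p * log 2 (obs_from x (map l zs) / p)
          \<le> mu x * p * - log 2 (mu x * p / Ob)"
        using mx 2 by (intro mult_left_mono) auto
      then show ?thesis by (simp add: p_def Ob_def mult.assoc)
    qed
  qed
  finally show ?thesis .
qed

text \<open>By the polynomial count an untrackable class violates \<open>loops_unique\<close>. Both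
  loops begin with v; removing this entry gives the words a and b that \<open>chain_prob P v\<close>
  weighs.\<close>

lemma untrackable_class_loops:
  assumes i: "recurrent V E i"
    and "\<not> trackable (recurrent_class E i)
      (E \<inter> (recurrent_class E i \<times> recurrent_class E i)) l Phi"
  obtains v a b L where "recurrent V E v" "a \<in> seqs V L" "b \<in> seqs V L" "a \<noteq> b" "map l a = map l b"
    "chain_prob P v a > 0" "last (v # a) = v" "chain_prob P v b > 0" "last (v # b) = v"
proof -
  define C where "C = recurrent_class E i"
  have iV: "i \<in> V" using i by (simp add: recurrent_def)
  have CV: "C \<subseteq> V" using iV accessible_in_V by (auto simp: C_def recurrent_class_def)
  have "Phi \<noteq> {}" using lV V_nonempty by auto
  then have "\<not> loops_unique C (E \<inter> (C \<times> C)) l"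
    using assms(2) loops_unique_imp_trackable finPhi finite_subset[OF CV finV]
    unfolding C_def by blast
  then obtain ys xs xs' where w: "xs \<in> walks C (E \<inter> (C \<times> C)) l ys" "xs' \<in> walks C (E \<inter> (C \<times> C)) l ys"
    and h: "xs \<noteq> []" "hd xs = last xs" "hd xs' = hd xs" "last xs' = last xs" "xs \<noteq> xs'"
    unfolding loops_unique_def by blast
  obtain v a where xs: "xs = v # a" using h by (cases xs) auto
  have len: "length xs = length xs'" using w by (simp add: walks_def)
  then obtain b where xs': "xs' = v # b" using h xs by (cases xs') auto
  have col: "map l zs = ys" if "zs \<in> walks C (E \<inter> (C \<times> C)) l ys" for zs
    using that by (auto simp: walks_def intro: nth_equalityI)
  have vC: "v \<in> C" using w xs by (auto simp: walks_def)
  \<comment> \<open>Whatever v reaches is accessible from i, so it leads back to i and thence to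
    v.\<close>
  have "recurrent V E v"
    using i vC CV unfolding C_def recurrent_class_def recurrent_def accessible_def
    by (auto intro: rtrancl_trans)
  moreover have "a \<in> seqs V (length a)" "b \<in> seqs V (length a)"
    using w CV len xs xs' by (auto simp: walks_def seqs_def)
  moreover have "a \<noteq> b" using h xs xs' by simp
  moreover have "map l a = map l b" using col[OF w(1)] col[OF w(2)] xs xs' by auto
  moreover have "chain_prob P v zs > 0" if "v # zs \<in> walks C (E \<inter> (C \<times> C)) l ys" for zs
    using that vC CV by (subst chain_prob_pos_iff) (auto simp: walks_def)
  moreover have "last (v # a) = v" "last (v # b) = v" using h xs xs' by auto
  ultimately show thesis using that w xs xs' by blast
qed

lemma untrackable_class_imp_rate_pos:
  assumes "recurrent V E i"
    and "\<not> trackable (recurrent_class E i)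
      (E \<inter> (recurrent_class E i \<times> recurrent_class E i)) l Phi"
  shows "cond_entropy_rate V l P mu > 0"
proof -
  obtain v a b L where v: "recurrent V E v" and loops: "a \<in> seqs V L" "b \<in> seqs V L" "a \<noteq> b"
    "map l a = map l b" "chain_prob P v a > 0" "last (v # a) = v" "chain_prob P v b > 0"
    "last (v # b) = v"
    by (rule untrackable_class_loops[OF assms]) (rule that)
  obtain \<alpha> \<gamma> where \<alpha>: "\<alpha> > 0" and lin: "\<And>T. \<alpha> * real T - \<gamma> \<le> entropy_from v T"
    by (rule entropy_from_linear[OF v loops(1,5,6,2,7,8,3,4)]) (rule that)
  have vV: "v \<in> V" using v by (simp add: recurrent_def)
  define m where "m = mu v"
  have m: "m > 0" using mu_pos[OF vV] by (simp add: m_def)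
  \<comment> \<open>The shift by 1 arises because \<open>entropy_from\<close> does not count the
    first state.\<close>
  have "m * (\<alpha> * (real T - 1) - \<gamma>) / real T \<le> cond_entropy V l P mu T / real T" if "T \<ge> 1" for T
  proof -
    obtain T' where T: "T = Suc T'" using \<open>T \<ge> 1\<close> by (cases T) auto
    have "m * (\<alpha> * real T' - \<gamma>) \<le> m * entropy_from v T'" using lin m by simp
    also have "\<dots> \<le> cond_entropy V l P mu T" unfolding T m_def by (rule cond_entropy_ge[OF vV])
    finally show ?thesis by (simp add: T divide_right_mono)
  qed
  then have ev: "\<forall>\<^sub>F T in sequentially. ereal (m * (\<alpha> * (real T - 1) - \<gamma>) / real T)
      \<le> ereal (cond_entropy V l P mu T / real T)"
    by (auto simp: eventually_at_top_linorder)
  have "(\<lambda>T. m * (\<alpha> * (real T - 1) - \<gamma>) / real T) \<longlonglongrightarrow> m * \<alpha>"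
    by real_asymp
  then have "(\<lambda>T. ereal (m * (\<alpha> * (real T - 1) - \<gamma>) / real T)) \<longlonglongrightarrow> ereal (m * \<alpha>)"
    by simp
  then have "limsup (\<lambda>T. ereal (m * (\<alpha> * (real T - 1) - \<gamma>) / real T)) = ereal (m * \<alpha>)"
    by (intro lim_imp_Limsup) auto
  then have "ereal (m * \<alpha>) \<le> cond_entropy_rate V l P mu"
    unfolding cond_entropy_rate_def using Limsup_mono[OF ev] by simp
  moreover have "0 < ereal (m * \<alpha>)" using m \<alpha> by simp
  ultimately show ?thesis by (rule less_le_trans[rotated])
qed

end

theorem theorem5:
  fixes V :: "'v set" and E :: "('v \<times> 'v) set" and l :: "'v \<Rightarrow> 'c" and Phi :: "'c set"
    and P :: "'v \<Rightarrow> 'v \<Rightarrow> real" and mu :: "'v \<Rightarrow> real"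
  assumes "weak_model V E l Phi"
    and "\<forall>i. recurrent V E i \<longrightarrow> aperiodic E i"
    and "markov_chain V E P mu"
  shows "cond_entropy_rate V l P mu = 0 \<longleftrightarrow>
    (\<forall>i. recurrent V E i \<longrightarrow>
       trackable (recurrent_class E i) (E \<inter> (recurrent_class E i \<times> recurrent_class E i)) l Phi)"
proof -
  interpret observed_chain V E l Phi P mu
    using assms by unfold_locales
  show ?thesis
    using trackable_classes_imp_rate_zero untrackable_class_imp_rate_pos
    by (metis less_irrefl)
qed

end
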